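(* Let $T \in \mathbb{F}^{n_1} \otimes \mathbb{F}^{n_2} \otimes \mathbb{F}^{n_3}$ be concise. Then $\lim_{m\to\infty} Q(T^{\boxtimes m})^{1/m} \geq (\min_i n_i)^{1/4}$.
   Context: $\mathbb{F}$ is any field. $T$ is concise if each of its three flattenings (the $n_i\times(n_jn_k)$ matrices obtained by grouping two tensor legs) has rank $n_i$. The subrank $Q(T)$ is the largest $r$ such that there are linear maps $L_i:\mathbb{F}^{n_i}\to\mathbb{F}^r$ with $(L_1\otimes L_2\otimes L_3)T=\sum_{i=1}^r e_i\otimes e_i\otimes e_i$; $\boxtimes$ denotes the Kronecker product of tensors, and $\lim_{m\to\infty} Q(T^{\boxtimes m})^{1/m}$ is the asymptotic subrank. *)

theory Defs
  imports Complex_Main "Jordan_Normal_Form.DL_Rank"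
begin

text \<open>
  An element of \<open>F\<^sup>n\<^sup>1 \<otimes> F\<^sup>n\<^sup>2 \<otimes> F\<^sup>n\<^sup>3\<close> is represented by its coordinate array in the standard
  basis, with indices starting at 0. Requiring the array to vanish outside the index box makes this
  representation unique, so that equality of tensors is equality of functions.
\<close>

type_synonym 'a tensor3 = "nat \<Rightarrow> nat \<Rightarrow> nat \<Rightarrow> 'a"

definition carrier_tensor3 :: "nat \<Rightarrow> nat \<Rightarrow> nat \<Rightarrow> 'a::zero tensor3 set" where
  "carrier_tensor3 n1 n2 n3 =
     {T. \<forall>i j k. T i j k \<noteq> 0 \<longrightarrow> i < n1 \<and> j < n2 \<and> k < n3}"

text \<open>The pair of grouped indices \<open>(x, y)\<close> with \<open>y < n\<close> is encoded as \<open>x * n + y\<close>.\<close>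

definition flattening1 :: "nat \<Rightarrow> nat \<Rightarrow> nat \<Rightarrow> 'a tensor3 \<Rightarrow> 'a mat" where
  "flattening1 n1 n2 n3 T = mat n1 (n2 * n3) (\<lambda>(i, q). T i (q div n3) (q mod n3))"

definition flattening2 :: "nat \<Rightarrow> nat \<Rightarrow> nat \<Rightarrow> 'a tensor3 \<Rightarrow> 'a mat" where
  "flattening2 n1 n2 n3 T = mat n2 (n1 * n3) (\<lambda>(j, q). T (q div n3) j (q mod n3))"

definition flattening3 :: "nat \<Rightarrow> nat \<Rightarrow> nat \<Rightarrow> 'a tensor3 \<Rightarrow> 'a mat" where
  "flattening3 n1 n2 n3 T = mat n3 (n1 * n2) (\<lambda>(k, q). T (q div n2) (q mod n2) k)"

definition concise :: "nat \<Rightarrow> nat \<Rightarrow> nat \<Rightarrow> 'a::field tensor3 \<Rightarrow> bool" where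
  "concise n1 n2 n3 T \<longleftrightarrow>
     vec_space.rank n1 (flattening1 n1 n2 n3 T) = n1 \<and>
     vec_space.rank n2 (flattening2 n1 n2 n3 T) = n2 \<and>
     vec_space.rank n3 (flattening3 n1 n2 n3 T) = n3"

text \<open>\<open>(A \<otimes> B \<otimes> C) T\<close> for linear maps given by their matrices.\<close>

definition tensor3_map ::
    "'a::comm_semiring_0 mat \<Rightarrow> 'a mat \<Rightarrow> 'a mat \<Rightarrow> 'a tensor3 \<Rightarrow> 'a tensor3" where
  "tensor3_map A B C T = (\<lambda>a b c.
     if a < dim_row A \<and> b < dim_row B \<and> c < dim_row C
     then \<Sum>i<dim_col A. \<Sum>j<dim_col B. \<Sum>k<dim_col C.
            A $$ (a, i) * B $$ (b, j) * C $$ (c, k) * T i j k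
     else 0)"

text \<open>The sum of \<open>e\<^sub>i \<otimes> e\<^sub>i \<otimes> e\<^sub>i\<close> over \<open>i < r\<close>.\<close>

definition unit_tensor3 :: "nat \<Rightarrow> 'a::zero_neq_one tensor3" where
  "unit_tensor3 r = (\<lambda>i j k. if i < r \<and> i = j \<and> j = k then 1 else 0)"

definition restricts_to_unit :: "nat \<Rightarrow> nat \<Rightarrow> nat \<Rightarrow> 'a::field tensor3 \<Rightarrow> nat \<Rightarrow> bool" where
  "restricts_to_unit n1 n2 n3 T r \<longleftrightarrow>
     (\<exists>L1 \<in> carrier_mat r n1. \<exists>L2 \<in> carrier_mat r n2. \<exists>L3 \<in> carrier_mat r n3.
        tensor3_map L1 L2 L3 T = unit_tensor3 r)"

text \<open>\<open>r = 0\<close> always qualifies and every such \<open>r\<close> is at most \<open>n1\<close>, so the maximum exists.\<close>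

definition subrank :: "nat \<Rightarrow> nat \<Rightarrow> nat \<Rightarrow> 'a::field tensor3 \<Rightarrow> nat" where
  "subrank n1 n2 n3 T = (GREATEST r. restricts_to_unit n1 n2 n3 T r)"

text \<open>
  Kronecker product of \<open>S\<close> with a tensor \<open>T\<close> of format \<open>n1 \<times> n2 \<times> n3\<close>; the index pair \<open>(i, i')\<close>
  is encoded as \<open>i * n1 + i'\<close>, and likewise for the other two legs.
\<close>

definition kron3 ::
    "nat \<Rightarrow> nat \<Rightarrow> nat \<Rightarrow> 'a::times tensor3 \<Rightarrow> 'a tensor3 \<Rightarrow> 'a tensor3" where
  "kron3 n1 n2 n3 S T = (\<lambda>i j k.
     S (i div n1) (j div n2) (k div n3) * T (i mod n1) (j mod n2) (k mod n3))"

text \<open>The \<open>m\<close>-th Kronecker power, a tensor of format \<open>n1 ^ m \<times> n2 ^ m \<times> n3 ^ m\<close>.\<close>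

primrec kron3_power ::
    "nat \<Rightarrow> nat \<Rightarrow> nat \<Rightarrow> 'a::field tensor3 \<Rightarrow> nat \<Rightarrow> 'a tensor3" where
  "kron3_power n1 n2 n3 T 0 = unit_tensor3 1"
| "kron3_power n1 n2 n3 T (Suc m) = kron3 n1 n2 n3 (kron3_power n1 n2 n3 T m) T"

definition subrank_root :: "nat \<Rightarrow> nat \<Rightarrow> nat \<Rightarrow> 'a::field tensor3 \<Rightarrow> nat \<Rightarrow> real" where
  "subrank_root n1 n2 n3 T m =
     root m (real (subrank (n1 ^ m) (n2 ^ m) (n3 ^ m) (kron3_power n1 n2 n3 T m)))"

definition asymptotic_subrank :: "nat \<Rightarrow> nat \<Rightarrow> nat \<Rightarrow> 'a::field tensor3 \<Rightarrow> real" where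
  "asymptotic_subrank n1 n2 n3 T = lim (subrank_root n1 n2 n3 T)"

end

theory Submission
  imports Defs
begin

text \<open>
  Let \<open>Q\<^sub>i\<close> be the maximal rank of a matrix in the span of the slices of a concise tensor in direction
  \<open>i\<close>. For \<open>i \<noteq> j\<close> the product \<open>Q\<^sub>i * Q\<^sub>j\<close> is at least a constant times the remaining dimension, so two
  of the three directions contain matrices of rank at least \<open>N powr (1/2) / 2\<close>, where \<open>N\<close> is the
  smallest dimension. Each of these matrices is a restriction of \<open>T\<close>, and their Kronecker product, a
  restriction of \<open>T \<boxtimes> T\<close>, contains a diagonal of that size. Hence \<open>Q(T \<boxtimes> T)\<close> is at least
  \<open>N powr (1/2) / 2\<close>; applied to the Kronecker powers of \<open>T\<close>, which are concise as well, this bounds the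
  limit from below by \<open>N powr (1/4)\<close>, as the constant disappears. The limit exists and
  dominates every term by Fekete's lemma for supermultiplicative sequences.
\<close>

subsection \<open>Linear functionals and dual systems\<close>

text \<open>Vectors are arbitrary functions on \<open>nat\<close>; finite dimension enters only
  through the number of functionals imposed or of coordinates used.\<close>

definition lin :: "((nat \<Rightarrow> 'a::field) \<Rightarrow> 'a) \<Rightarrow> bool" where
  "lin f \<longleftrightarrow> (\<forall>c d u v. f (\<lambda>i. c * u i + d * v i) = c * f u + d * f v)"

lemma lin_comb: "lin f \<Longrightarrow> f (\<lambda>i. c * u i + d * v i) = c * f u + d * f v"
  unfolding lin_def by blast

lemma lin_add: "lin f \<Longrightarrow> f (\<lambda>i. u i + v i) = f u + f v"
  using lin_comb[of f 1 u 1 v] by simp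

lemma lin_scale: "lin f \<Longrightarrow> f (\<lambda>i. c * u i) = c * f u"
  using lin_comb[of f c u 0 u] by simp

lemma lin_zero: "lin f \<Longrightarrow> f (\<lambda>i. 0) = 0"
  using lin_comb[of f 0 "\<lambda>i. 0" 0 "\<lambda>i. 0"] by simp

lemma lin_sum: "lin f \<Longrightarrow> f (\<lambda>i. \<Sum>s<n::nat. c s * u s i) = (\<Sum>s<n. c s * f (u s))"
proof (induction n)
  case 0
  then show ?case using lin_zero[of f] by simp
next
  case (Suc n)
  then show ?case
    using lin_add[of f "\<lambda>i. \<Sum>s<n. c s * u s i" "\<lambda>i. c n * u n i"] lin_scale[of f "c n" "u n"] by simp
qed

lemma lin_diff_sum:
  "lin f \<Longrightarrow> f (\<lambda>i. u i - (\<Sum>s<n::nat. c s * v s i)) = f u - (\<Sum>s<n. c s * f (v s))"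
  using lin_comb[of f 1 u "- 1" "\<lambda>i. \<Sum>s<n. c s * v s i"] lin_sum[of f c v n] by simp

lemma lin_coord_sum: "lin (\<lambda>u. \<Sum>i<n::nat. c i * u i)"
  unfolding lin_def sum_distrib_left sum.distrib[symmetric]
  by (intro allI sum.cong) (auto simp: algebra_simps)

lemma lin_compose_sum: "lin f \<Longrightarrow> lin (\<lambda>\<alpha>. f (\<lambda>i. \<Sum>s<n::nat. \<alpha> s * u s i))"
  using lin_coord_sum[of "\<lambda>s. f (u s)" n] by (simp only: lin_sum mult.commute)

text \<open>Padded with zero rows to a square matrix, a system with fewer equations than unknowns
  has a zero last row, hence determinant 0 and a kernel vector.\<close>

lemma common_zero:
  fixes G :: "((nat \<Rightarrow> 'a::field) \<Rightarrow> 'a) set"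
  assumes "finite G" "card G < n" "\<And>g. g \<in> G \<Longrightarrow> lin g"
  shows "\<exists>\<alpha>. (\<exists>i<n. \<alpha> i \<noteq> 0) \<and> (\<forall>g\<in>G. g \<alpha> = 0)"
proof -
  obtain h where h: "bij_betw h {0..<card G} G"
    using ex_bij_betw_nat_finite assms(1) by blast
  define e :: "nat \<Rightarrow> nat \<Rightarrow> 'a" where "e j = (\<lambda>i. if i = j then 1 else 0)" for j
  define A where "A = mat n n (\<lambda>(i, j). if i < card G then h i (e j) else 0)"
  have A: "A \<in> carrier_mat n n" by (simp add: A_def)
  have "A = mat\<^sub>r n n (\<lambda>i. if i = n - 1 then 0\<^sub>v n else row A i)"
    using assms(2) by (intro eq_matI) (auto simp: A_def)
  then have "det A = 0"
    using det_row_0[of "n - 1" n "row A"] assms(2) A by (simp add: row_carrier_vec)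
  then obtain v where v: "v \<in> carrier_vec n" "v \<noteq> 0\<^sub>v n" "A *\<^sub>v v = 0\<^sub>v n"
    using det_0_iff_vec_prod_zero_field[OF A] by auto
  \<comment> \<open>Extended by 0, the kernel vector is a finite combination of unit vectors, so an
    abstract functional can be evaluated through its matrix row.\<close>
  define \<alpha> where "\<alpha> i = (if i < n then v $ i else 0)" for i
  have "\<exists>i<n. \<alpha> i \<noteq> 0"
    using v(1,2) by (auto simp: \<alpha>_def vec_eq_iff)
  moreover have "g \<alpha> = 0" if g: "g \<in> G" for g
  proof -
    obtain i where i: "i < card G" "g = h i"
      using h g unfolding bij_betw_def by (metis atLeastLessThan_iff imageE)
    have \<alpha>: "\<alpha> = (\<lambda>i. \<Sum>s<n. \<alpha> s * e s i)"
      by (auto simp: fun_eq_iff \<alpha>_def e_def sum.delta' if_distrib[of "\<lambda>z. _ * z"] cong: if_cong)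
    have "g \<alpha> = (\<Sum>s<n. \<alpha> s * g (e s))"
      by (subst \<alpha>) (rule lin_sum[OF assms(3)[OF g]])
    also have "\<dots> = (A *\<^sub>v v) $ i"
      using i v(1) assms(2)
      by (auto simp: A_def \<alpha>_def scalar_prod_def mult.commute atLeast0LessThan intro!: sum.cong)
    also have "\<dots> = 0"
      using v(3) i assms(2) by simp
    finally show ?thesis .
  qed
  ultimately show ?thesis
    by (intro exI[of _ \<alpha>]) simp
qed

definition zeros :: "('v \<Rightarrow> 'a::zero) set \<Rightarrow> 'v set" where
  "zeros G = {u. \<forall>g\<in>G. g u = 0}"

lemma zerosI: "(\<And>g. g \<in> G \<Longrightarrow> g u = 0) \<Longrightarrow> u \<in> zeros G"
  by (simp add: zeros_def)

lemma zerosD: "u \<in> zeros G \<Longrightarrow> g \<in> G \<Longrightarrow> g u = 0"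
  by (simp add: zeros_def)

lemma zeros_sum:
  assumes "\<And>g. g \<in> G \<Longrightarrow> lin g" and "\<And>s. s < n \<Longrightarrow> v s \<in> zeros G"
  shows "(\<lambda>i. \<Sum>s<n::nat. c s * v s i) \<in> zeros G"
proof (rule zerosI)
  fix g assume g: "g \<in> G"
  have "(\<Sum>s<n. c s * g (v s)) = 0"
    using zerosD[OF assms(2) g] by (intro sum.neutral) simp
  then show "g (\<lambda>i. \<Sum>s<n. c s * v s i) = 0"
    by (simp only: lin_sum[OF assms(1)[OF g]])
qed

lemma zeros_diff:
  assumes "\<And>g. g \<in> G \<Longrightarrow> lin g" and "u \<in> zeros G" "v \<in> zeros G"
  shows "(\<lambda>i. u i - v i) \<in> zeros G"
proof (rule zerosI)
  fix g assume g: "g \<in> G"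
  show "g (\<lambda>i. u i - v i) = 0"
    using lin_comb[OF assms(1)[OF g], of 1 u "- 1" v] zerosD[OF assms(2) g] zerosD[OF assms(3) g] by simp
qed

section \<open>Bilinear forms, dual systems and kernels\<close>

definition bilin :: "((nat \<Rightarrow> 'a::field) \<Rightarrow> (nat \<Rightarrow> 'a) \<Rightarrow> 'a) \<Rightarrow> bool" where
  "bilin b \<longleftrightarrow> (\<forall>w. lin (\<lambda>u. b u w)) \<and> (\<forall>u. lin (b u))"

lemma bilin_left: "bilin b \<Longrightarrow> lin (\<lambda>u. b u w)"
  and bilin_right: "bilin b \<Longrightarrow> lin (b u)"
  by (simp_all add: bilin_def)

text \<open>A witness that \<open>b\<close> restricted to \<open>P \<times> Q\<close> has rank at least \<open>k\<close>.\<close>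

definition dual_system ::
    "('v \<Rightarrow> 'w \<Rightarrow> 'a::zero_neq_one) \<Rightarrow> 'v set \<Rightarrow> 'w set \<Rightarrow> nat \<Rightarrow> (nat \<Rightarrow> 'v) \<Rightarrow> (nat \<Rightarrow> 'w) \<Rightarrow> bool" where
  "dual_system b P Q k u w \<longleftrightarrow>
     (\<forall>i<k. u i \<in> P \<and> w i \<in> Q) \<and> (\<forall>i<k. \<forall>j<k. b (u i) (w j) = (if i = j then 1 else 0))"

lemma dual_system_mono: "dual_system b P Q k u w \<Longrightarrow> l \<le> k \<Longrightarrow> dual_system b P Q l u w"
  unfolding dual_system_def by (meson order_less_le_trans)

lemma dual_system_append:
  assumes "dual_system b P Q k u w" "dual_system b P Q l p q"
    and "\<And>i j. i < k \<Longrightarrow> j < l \<Longrightarrow> b (u i) (q j) = 0" "\<And>i j. i < l \<Longrightarrow> j < k \<Longrightarrow> b (p i) (w j) = 0"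
  shows "dual_system b P Q (k + l) (\<lambda>i. if i < k then u i else p (i - k))
           (\<lambda>i. if i < k then w i else q (i - k))"
  unfolding dual_system_def
proof (intro conjI allI impI)
  fix i j assume "i < k + l" "j < k + l"
  then show "b (if i < k then u i else p (i - k)) (if j < k then w j else q (j - k)) = (if i = j then 1 else 0)"
    using assms by (auto simp: dual_system_def)
qed (use assms in \<open>auto simp: dual_system_def\<close>)

text \<open>A nonzero \<open>b x z\<close> would yield a pair \<open>x'\<close>, \<open>z'\<close>
  that extends the dual system. So the functionals \<open>b (u i)\<close> alone cut out the right
  kernel of \<open>b\<close>.\<close>

lemma maximal_dual_system_kernel:
  assumes b: "bilin b" and d: "dual_system b UNIV UNIV k u w"
    and max: "\<And>u' w'. \<not> dual_system b UNIV UNIV (Suc k) u' w'"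
    and z: "\<And>i. i < k \<Longrightarrow> b (u i) z = 0"
  shows "b x z = 0"
proof (rule ccontr)
  assume nz: "b x z \<noteq> 0"
  \<comment> \<open>Subtracting the \<open>u\<close>-components gives \<open>b x' (w j) = 0\<close>
    for every \<open>j < k\<close>; \<open>b x' z = b x z\<close> because each
    \<open>b (u i) z\<close> is 0.\<close>
  define x' where "x' = (\<lambda>i. x i - (\<Sum>s<k. b x (w s) * u s i))"
  define z' where "z' = (\<lambda>i. inverse (b x z) * z i)"
  have bx': "b x' y = b x y - (\<Sum>s<k. b x (w s) * b (u s) y)" for y
    unfolding x'_def by (rule lin_diff_sum[OF bilin_left[OF b]])
  have 1: "b x' (w j) = 0" if "j < k" for j
    using d that by (simp add: bx' dual_system_def if_distrib[of "\<lambda>z. _ * z"] cong: if_cong)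
  have bz': "b y z' = inverse (b x z) * b y z" for y
    unfolding z'_def by (rule lin_scale[OF bilin_right[OF b]])
  have 2: "b (u i) z' = 0" if "i < k" for i
    using z[OF that] by (simp add: bz')
  have "b x' z = b x z"
    using z by (simp add: bx')
  then have "dual_system b UNIV UNIV 1 (\<lambda>_. x') (\<lambda>_. z')"
    using nz by (simp add: dual_system_def bz')
  from dual_system_append[OF d this]
  have "dual_system b UNIV UNIV (k + 1) (\<lambda>i. if i < k then u i else (\<lambda>_. x') (i - k))
           (\<lambda>i. if i < k then w i else (\<lambda>_. z') (i - k))"
    using 1 2 by blast
  then show False using max by simp
qed

text \<open>The right kernel has codimension at most the rank, expressed by functionals: they come
  from a dual system of greatest size.\<close>

lemma kernel_of_small_rank:
  assumes b: "bilin b" and max: "\<And>u w. \<not> dual_system b UNIV UNIV (Suc k) u w"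
  shows "\<exists>K. finite K \<and> card K \<le> k \<and> (\<forall>g\<in>K. lin g) \<and> (\<forall>z\<in>zeros K. \<forall>x. b x z = 0)"
proof -
  define D where "D l \<longleftrightarrow> (\<exists>u w. dual_system b UNIV UNIV l u w)" for l
  have bound: "l \<le> k" if "D l" for l
    using that max dual_system_mono[of b UNIV UNIV l _ _ "Suc k"] by (force simp: D_def not_less_eq_eq)
  have "D 0" by (simp add: D_def dual_system_def)
  define l where "l = (GREATEST l. D l)"
  have "D l" unfolding l_def using \<open>D 0\<close> bound by (metis GreatestI_nat)
  have "\<not> D (Suc l)" unfolding l_def using bound Greatest_le_nat[of D "Suc l" k] l_def by auto
  from \<open>D l\<close> obtain u w where d: "dual_system b UNIV UNIV l u w" by (auto simp: D_def)
  have "card ((\<lambda>i. b (u i)) ` {..<l}) \<le> k"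
    using card_image_le[of "{..<l}" "\<lambda>i. b (u i)"] bound[OF \<open>D l\<close>] by simp
  moreover have "b x z = 0" if "z \<in> zeros ((\<lambda>i. b (u i)) ` {..<l})" for x z
    using maximal_dual_system_kernel[OF b d] \<open>\<not> D (Suc l)\<close> that by (auto simp: D_def zeros_def)
  ultimately show ?thesis
    using bilin_right[OF b] by (intro exI[of _ "(\<lambda>i. b (u i)) ` {..<l}"]) auto
qed

text \<open>Subadditivity of rank: \<open>b2 - b1\<close> is the identity matrix of size \<open>r\<close>.\<close>

lemma dual_system_of_difference:
  assumes b: "bilin b1" "bilin b2"
    and diff: "\<And>\<alpha> \<beta>. b2 \<alpha> \<beta> - b1 \<alpha> \<beta> = (\<Sum>s<r::nat. \<alpha> s * \<beta> s)"
    and "k1 + k2 < r"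
  shows "(\<exists>u w. dual_system b1 UNIV UNIV (Suc k1) u w) \<or> (\<exists>u w. dual_system b2 UNIV UNIV (Suc k2) u w)"
proof (rule ccontr)
  assume "\<not> ?thesis"
  then obtain K1 K2
    where K1: "finite K1" "card K1 \<le> k1" "\<forall>g\<in>K1. lin g" "\<forall>z\<in>zeros K1. \<forall>x. b1 x z = 0"
      and K2: "finite K2" "card K2 \<le> k2" "\<forall>g\<in>K2. lin g" "\<forall>z\<in>zeros K2. \<forall>x. b2 x z = 0"
    using kernel_of_small_rank[OF b(1), of k1] kernel_of_small_rank[OF b(2), of k2] by metis
  \<comment> \<open>Fewer than \<open>r\<close> conditions leave a nonzero \<beta> in both right
    kernels, although the difference of the two forms is nondegenerate on the first \<open>r\<close>
    coordinates.\<close>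
  have "card (K1 \<union> K2) < r"
    using card_Un_le[of K1 K2] K1 K2 assms(4) by simp
  then obtain \<beta> where \<beta>: "\<exists>i<r. \<beta> i \<noteq> 0" "\<forall>g\<in>K1 \<union> K2. g \<beta> = 0"
    using common_zero[of "K1 \<union> K2" r] K1(1,3) K2(1,3) by (metis UnE finite_UnI)
  then obtain i where i: "i < r" "\<beta> i \<noteq> 0" by blast
  have "b2 (\<lambda>s. if s = i then 1 else 0) \<beta> - b1 (\<lambda>s. if s = i then 1 else 0) \<beta> = \<beta> i"
    using i(1) by (simp add: diff if_distrib[of "\<lambda>z. z * _"] cong: if_cong)
  moreover have "\<beta> \<in> zeros K1" "\<beta> \<in> zeros K2"
    using \<beta>(2) by (auto intro: zerosI)
  ultimately show False using K1(4) K2(4) i(2) by simp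
qed

section \<open>Slices restricted to orthogonal complements\<close>

text \<open>
  Let \<open>t x\<close> have maximal rank \<open>r0\<close> among the slices of \<open>t\<close>. On the orthogonal complements of a
  dual system for \<open>t x\<close>, every other slice \<open>t y\<close> has rank at most \<open>r0 div 2\<close>: otherwise one of
  \<open>t y\<close> and \<open>t (x + y)\<close> would have rank more than \<open>r0\<close>, as their Schur complements differ by the
  identity of size \<open>r0\<close>. Iterating costs \<open>r0 + r0 div 2 + \<dots> \<le> 2 * r0\<close> conditions over any field.
\<close>

lemma restricted_slices_rank:
  assumes left: "\<And>u w. lin (\<lambda>x. t x u w)" and bil: "\<And>x. bilin (t x)"
    and G: "\<And>g. g \<in> G \<Longrightarrow> lin g" and H: "\<And>h. h \<in> H \<Longrightarrow> lin h"
    and max: "\<And>x u w. \<not> dual_system (t x) (zeros G) (zeros H) (Suc r) u w"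
    and d: "dual_system (t x) (zeros G) (zeros H) r u w" and "r > 0"
    and P: "P = zeros (G \<union> (\<lambda>s u. t x u (w s)) ` {..<r})"
    and Q: "Q = zeros (H \<union> (\<lambda>s. t x (u s)) ` {..<r})"
  shows "\<not> dual_system (t y) P Q (Suc (r div 2)) p q"
proof
  let ?l = "Suc (r div 2)"
  assume e: "dual_system (t y) P Q ?l p q"
  have lin_l: "lin (\<lambda>u. t x u w)" and lin_r: "lin (t x u)" for x u w
    using bilin_left[OF bil] bilin_right[OF bil] by blast+
  \<comment> \<open>Projecting along \<open>p\<close> and \<open>q\<close> makes \<open>u'\<close>
    orthogonal to \<open>q\<close>, and \<open>w'\<close> to \<open>p\<close>, under both
    \<open>t x\<close> and \<open>t y\<close>, while \<open>t x\<close> still pairs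
    \<open>u'\<close> and \<open>w'\<close> to the identity.\<close>
  define u' where "u' s = (\<lambda>i. u s i - (\<Sum>j<?l. t y (u s) (q j) * p j i))" for s
  define w' where "w' s = (\<lambda>i. w s i - (\<Sum>j<?l. t y (p j) (w s) * q j i))" for s
  have u': "g (u' s) = g (u s) - (\<Sum>j<?l. t y (u s) (q j) * g (p j))" if "lin g" for g s
    unfolding u'_def by (rule lin_diff_sum[OF that])
  have w': "g (w' s) = g (w s) - (\<Sum>j<?l. t y (p j) (w s) * g (q j))" if "lin g" for g s
    unfolding w'_def by (rule lin_diff_sum[OF that])
  have xp: "t x (p j) (w s) = 0" if "j < ?l" "s < r" for j s
  proof -
    have "p j \<in> P" using e that(1) unfolding dual_system_def by blast
    then show ?thesis using that(2) unfolding P by (auto dest!: zerosD[where g = "\<lambda>u. t x u (w s)"])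
  qed
  have xq: "t x (u s) (q j) = 0" if "j < ?l" "s < r" for j s
  proof -
    have "q j \<in> Q" using e that(1) unfolding dual_system_def by blast
    then show ?thesis using that(2) unfolding Q by (auto dest!: zerosD[where g = "t x (u s)"])
  qed
  have pG: "p j \<in> zeros G" and qH: "q j \<in> zeros H" if "j < ?l" for j
    using e that unfolding dual_system_def P Q zeros_def by auto
  have upG: "u s \<in> zeros G" and wqH: "w s \<in> zeros H" if "s < r" for s
    using d that unfolding dual_system_def by auto
  \<comment> \<open>A nonzero value, rescaled to 1, would extend the dual system of
    \<open>t x\<close> beyond the maximal size \<open>r\<close>.\<close>
  have xpq: "t x (p i) (q j) = 0" if "i < ?l" "j < ?l" for i j
  proof (rule ccontr)
    assume nz: "t x (p i) (q j) \<noteq> 0"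
    define z where "z = (\<lambda>k. inverse (t x (p i) (q j)) * q j k)"
    have z: "g z = inverse (t x (p i) (q j)) * g (q j)" if "lin g" for g
      unfolding z_def by (rule lin_scale[OF that])
    have "z \<in> zeros H"
      using qH[OF that(2)] H by (auto intro!: zerosI simp: z dest: zerosD)
    then have "dual_system (t x) (zeros G) (zeros H) 1 (\<lambda>_. p i) (\<lambda>_. z)"
      using pG[OF that(1)] nz z[OF lin_r[of x "p i"]] by (simp add: dual_system_def)
    moreover have "t x (u s) z = 0" if "s < r" for s
      using xq[OF \<open>j < ?l\<close> that] z[OF lin_r] by simp
    ultimately show False
      using dual_system_append[OF d, of 1 "\<lambda>_. p i" "\<lambda>_. z"] xp[OF that(1)] max by simp
  qed
  have x_uq: "t x (u' s) (q j) = 0" if "j < ?l" "s < r" for j s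
    using that by (simp add: u'[OF lin_l] xq xpq)
  have x_pw: "t x (p j) (w' s) = 0" if "j < ?l" "s < r" for j s
    using that by (simp add: w'[OF lin_r] xp xpq)
  have y_pq: "t y (p i) (q j) = (if i = j then 1 else 0)" if "i < ?l" "j < ?l" for i j
    using e that unfolding dual_system_def by blast
  have y_uq: "t y (u' s) (q j) = 0" if "j < ?l" "s < r" for j s
  proof -
    have "(\<Sum>i<?l. t y (u s) (q i) * t y (p i) (q j)) = (\<Sum>i<?l. if i = j then t y (u s) (q i) else 0)"
      using that by (intro sum.cong) (auto simp: y_pq)
    also have "\<dots> = t y (u s) (q j)"
      using that by (subst sum.delta) auto
    finally show ?thesis unfolding u'[OF lin_l] by simp
  qed
  have y_pw: "t y (p j) (w' s) = 0" if "j < ?l" "s < r" for j s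
  proof -
    have "(\<Sum>i<?l. t y (p i) (w s) * t y (p j) (q i)) = (\<Sum>i<?l. if i = j then t y (p i) (w s) else 0)"
      using that by (intro sum.cong) (auto simp: y_pq)
    also have "\<dots> = t y (p j) (w s)"
      using that by (subst sum.delta) auto
    finally show ?thesis unfolding w'[OF lin_r] by simp
  qed
  have x_uw: "t x (u' a) (w' b) = (if a = b then 1 else 0)" if "a < r" "b < r" for a b
  proof -
    have "t x (u' a) (w' b) = t x (u' a) (w b)"
      unfolding w'[OF lin_r] using that(1) by (simp add: x_uq)
    also have "\<dots> = t x (u a) (w b)"
      unfolding u'[OF lin_l] using that(2) by (simp add: xp)
    also have "\<dots> = (if a = b then 1 else 0)"
      using d that unfolding dual_system_def by blast
    finally show ?thesis .
  qed
  define U W where "U \<alpha> = (\<lambda>i. \<Sum>s<r. \<alpha> s * u' s i)" and "W \<beta> = (\<lambda>i. \<Sum>s<r. \<beta> s * w' s i)" for \<alpha> \<beta>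
  have U: "g (U \<alpha>) = (\<Sum>s<r. \<alpha> s * g (u' s))" and W: "g (W \<alpha>) = (\<Sum>s<r. \<alpha> s * g (w' s))"
    if "lin g" for g \<alpha>
    unfolding U_def W_def by (rule lin_sum[OF that])+
  \<comment> \<open>The form of the slice \<open>y + c * x\<close> on the spans of \<open>u'\<close>
    and \<open>w'\<close>. Only \<open>c = 0\<close> and \<open>c = 1\<close> are compared, so the
    field may have any size; the difference is \<open>t x\<close>, the identity of size
    \<open>r\<close>.\<close>
  define b where "b c \<alpha> \<beta> = t (\<lambda>i. 1 * y i + c * x i) (U \<alpha>) (W \<beta>)" for c \<alpha> \<beta>
  have b_bilin: "bilin (b c)" for c
    unfolding bilin_def b_def U_def W_def using lin_compose_sum lin_l lin_r by blast
  have t_add: "t (\<lambda>i. 1 * y i + c * x i) v z = t y v z + c * t x v z" for c v z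
    using lin_comb[OF left, of 1 y c x v z] by simp
  have "b 1 \<alpha> \<beta> - b 0 \<alpha> \<beta> = (\<Sum>s<r. \<alpha> s * \<beta> s)" for \<alpha> \<beta>
  proof -
    have "b 1 \<alpha> \<beta> - b 0 \<alpha> \<beta> = t x (U \<alpha>) (W \<beta>)"
      unfolding b_def t_add by simp
    also have "\<dots> = (\<Sum>a<r. \<alpha> a * t x (u' a) (W \<beta>))"
      by (rule U[OF lin_l])
    also have "\<dots> = (\<Sum>a<r. \<alpha> a * (\<Sum>b<r. \<beta> b * t x (u' a) (w' b)))"
      unfolding W[OF lin_r] ..
    also have "\<dots> = (\<Sum>a<r. \<alpha> a * (\<Sum>b<r. if b = a then \<beta> b else 0))"
      by (intro sum.cong arg_cong2[of _ _ _ _ "(*)"] refl) (auto simp: x_uw)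
    also have "\<dots> = (\<Sum>s<r. \<alpha> s * \<beta> s)"
      by (intro sum.cong) auto
    finally show ?thesis .
  qed
  \<comment> \<open>\<open>Suc k\<close> is half of \<open>r\<close> rounded up:
    \<open>k + k < r\<close> makes the difference argument applicable, and \<open>Suc k + ?l\<close>
    is \<open>Suc r\<close>, one above the maximal rank.\<close>
  moreover define k where "k = r - r div 2 - 1"
  have "k + k < r" using \<open>r > 0\<close> unfolding k_def by presburger
  ultimately obtain c \<alpha> \<beta> where c: "dual_system (b c) UNIV UNIV (Suc k) \<alpha> \<beta>"
    using dual_system_of_difference[OF b_bilin b_bilin, of 1 0 r k k] by blast
  let ?f = "t (\<lambda>i. 1 * y i + c * x i)"
  have u'G: "u' s \<in> zeros G" if "s < r" for s
    unfolding u'_def by (intro zeros_diff zeros_sum G upG that pG)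
  have w'H: "w' s \<in> zeros H" if "s < r" for s
    unfolding w'_def by (intro zeros_diff zeros_sum H wqH that qH)
  have "U (\<alpha> i) \<in> zeros G" for i
    unfolding U_def by (intro zeros_sum G u'G)
  moreover have "W (\<beta> i) \<in> zeros H" for i
    unfolding W_def by (intro zeros_sum H w'H)
  ultimately have "dual_system ?f (zeros G) (zeros H) (Suc k) (\<lambda>i. U (\<alpha> i)) (\<lambda>i. W (\<beta> i))"
    using c unfolding dual_system_def b_def by blast
  moreover have "dual_system ?f (zeros G) (zeros H) ?l p q"
    unfolding dual_system_def t_add using pG qH y_pq xpq by simp
  moreover have "?f (U (\<alpha> i)) (q j) = 0" if "j < ?l" for i j
    unfolding t_add U[OF lin_l] using that by (simp add: x_uq y_uq)
  moreover have "?f (p j) (W (\<beta> i)) = 0" if "j < ?l" for i j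
    unfolding t_add W[OF lin_r] using that by (simp add: x_pw y_pw)
  ultimately have "dual_system ?f (zeros G) (zeros H) (Suc k + ?l)
     (\<lambda>i. if i < Suc k then U (\<alpha> i) else p (i - Suc k)) (\<lambda>i. if i < Suc k then W (\<beta> i) else q (i - Suc k))"
    by (intro dual_system_append) auto
  moreover have "Suc k + ?l = Suc r"
    using \<open>r > 0\<close> unfolding k_def by presburger
  ultimately show False using max by metis
qed

text \<open>Induction on the rank bound. A slice of greatest rank \<open>r0\<close> supplies
  \<open>r0\<close> test vectors for \<open>V\<close> and \<open>r0\<close> conditions for
  \<open>K\<close>; on the complements the rank is at most \<open>r0 div 2\<close>, so both sets
  have at most \<open>r0 + 2 * (r0 div 2) \<le> 2 * r\<close> elements.\<close>

lemma slices_vanish_of_small_rank: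
  assumes left: "\<And>u w. lin (\<lambda>x. t x u w)" and bil: "\<And>x. bilin (t x)"
    and "\<And>g. g \<in> G \<Longrightarrow> lin g" "\<And>h. h \<in> H \<Longrightarrow> lin h"
    and "\<And>x u w. \<not> dual_system (t x) (zeros G) (zeros H) (Suc r) u w"
  shows "\<exists>V K. finite V \<and> card V \<le> 2 * r \<and> finite K \<and> card K \<le> 2 * r \<and> (\<forall>g\<in>K. lin g) \<and>
    (\<forall>w\<in>zeros (H \<union> K). \<forall>x. (\<forall>v\<in>V. t x v w = 0) \<longrightarrow> (\<forall>u\<in>zeros G. t x u w = 0))"
  using assms(3-5)
proof (induction r arbitrary: G H rule: less_induct)
  case (less r G H)
  note G = less.prems(1) and H = less.prems(2) and max = less.prems(3)
  have lin_l: "lin (\<lambda>u. t x u w)" and lin_r: "lin (t x u)" for x u w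
    using bilin_left[OF bil] bilin_right[OF bil] by blast+
  define D where "D l \<longleftrightarrow> (\<exists>x u w. dual_system (t x) (zeros G) (zeros H) l u w)" for l
  have bound: "l \<le> r" if "D l" for l
    using that max dual_system_mono[of _ "zeros G" "zeros H" l _ _ "Suc r"]
    unfolding D_def by (metis not_less_eq_eq)
  have "D 0" by (simp add: D_def dual_system_def)
  \<comment> \<open>The exact maximal rank, possibly below \<open>r\<close>: the halving step takes
    a dual system of this size and the absence of a larger one.\<close>
  define r0 where "r0 = (GREATEST l. D l)"
  have "D r0" unfolding r0_def using \<open>D 0\<close> bound by (metis GreatestI_nat)
  have "\<not> D (Suc r0)" unfolding r0_def using bound Greatest_le_nat[of D "Suc r0" r] r0_def by auto
  then have max0: "\<not> dual_system (t x) (zeros G) (zeros H) (Suc r0) u w" for x u w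
    by (auto simp: D_def)
  have "r0 \<le> r" using bound[OF \<open>D r0\<close>] .
  show ?case
  proof (cases "r0 = 0")
    case True
    have "t x u w = 0" if "w \<in> zeros H" "u \<in> zeros G" for x u w
    proof (rule ccontr)
      assume nz: "t x u w \<noteq> 0"
      define z where "z = (\<lambda>k. inverse (t x u w) * w k)"
      have z: "g z = inverse (t x u w) * g w" if "lin g" for g
        unfolding z_def by (rule lin_scale[OF that])
      have "z \<in> zeros H"
        using that(1) H by (auto intro!: zerosI simp: z dest: zerosD)
      then have "dual_system (t x) (zeros G) (zeros H) (Suc 0) (\<lambda>_. u) (\<lambda>_. z)"
        using that(2) nz z[OF lin_r[of x u]] by (simp add: dual_system_def)
      then show False using max0 True by blast
    qed
    then show ?thesis by (intro exI[of _ "{}"]) auto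
  next
    case False
    from \<open>D r0\<close> obtain x0 u w where d: "dual_system (t x0) (zeros G) (zeros H) r0 u w"
      unfolding D_def by blast
    \<comment> \<open>The new conditions on the left argument are imposed in the recursion and
      afterwards traded for the test vectors \<open>u\<close>; those on the right argument stay in
      the final set.\<close>
    define G1 where "G1 = G \<union> (\<lambda>s u. t x0 u (w s)) ` {..<r0}"
    define H0 where "H0 = (\<lambda>s. t x0 (u s)) ` {..<r0}"
    have "\<not> dual_system (t y) (zeros G1) (zeros (H \<union> H0)) (Suc (r0 div 2)) p q" for y p q
      using restricted_slices_rank[OF left bil G H max0 d] False unfolding G1_def H0_def by blast
    moreover have "r0 div 2 < r" using False \<open>r0 \<le> r\<close> by linarith
    moreover have "lin g" if "g \<in> G1" for g using that G lin_l unfolding G1_def by blast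
    moreover have "lin g" if "g \<in> H \<union> H0" for g using that H lin_r unfolding H0_def by blast
    ultimately obtain V K where V: "finite V" "card V \<le> 2 * (r0 div 2)"
      and K: "finite K" "card K \<le> 2 * (r0 div 2)" "\<forall>g\<in>K. lin g"
      and VK: "\<forall>z\<in>zeros ((H \<union> H0) \<union> K). \<forall>x. (\<forall>v\<in>V. t x v z = 0) \<longrightarrow> (\<forall>u\<in>zeros G1. t x u z = 0)"
      using less.IH[of "r0 div 2" G1 "H \<union> H0"] by blast
    have "card (V \<union> u ` {..<r0}) \<le> 2 * r"
      using card_Un_le[of V "u ` {..<r0}"] card_image_le[of "{..<r0}" u] V \<open>r0 \<le> r\<close> by simp
    moreover have "card (H0 \<union> K) \<le> 2 * r"
      using card_Un_le[of H0 K] card_image_le[of "{..<r0}" "\<lambda>s. t x0 (u s)"] K \<open>r0 \<le> r\<close>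
      unfolding H0_def by simp
    moreover have "t x v z = 0"
      if z: "z \<in> zeros (H \<union> (H0 \<union> K))" and V0: "\<forall>v\<in>V \<union> u ` {..<r0}. t x v z = 0" and v: "v \<in> zeros G" for x v z
    proof -
      \<comment> \<open>Removing its \<open>u\<close>-components brings \<open>v\<close> into
        \<open>zeros G1\<close>; the removed part contributes 0 because the \<open>u s\<close> are
        among the test vectors.\<close>
      define v' where "v' = (\<lambda>i. v i - (\<Sum>s<r0. t x0 v (w s) * u s i))"
      have v': "g v' = g v - (\<Sum>s<r0. t x0 v (w s) * g (u s))" if "lin g" for g
        unfolding v'_def by (rule lin_diff_sum[OF that])
      have "v' \<in> zeros G1"
      proof (rule zerosI)
        fix g assume "g \<in> G1"
        then consider "g \<in> G" | j where "j < r0" "g = (\<lambda>u. t x0 u (w j))"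
          unfolding G1_def by blast
        then show "g v' = 0"
        proof cases
          case 1
          have "u s \<in> zeros G" if "s < r0" for s
            using d that unfolding dual_system_def by blast
          then have "v' \<in> zeros G"
            unfolding v'_def by (intro zeros_diff zeros_sum G v)
          then show ?thesis using 1 by (rule zerosD)
        next
          case 2
          have "(\<Sum>s<r0. t x0 v (w s) * t x0 (u s) (w j)) = (\<Sum>s<r0. if s = j then t x0 v (w s) else 0)"
            using d 2(1) unfolding dual_system_def by (intro sum.cong) auto
          then show ?thesis
            using 2 v'[OF lin_l, of x0 "w j"] by simp
        qed
      qed
      moreover have "z \<in> zeros ((H \<union> H0) \<union> K)" using z by (simp add: Un_assoc)
      ultimately have "t x v' z = 0" using VK V0 by blast
      then show ?thesis using V0 v'[OF lin_l, of x z] by simp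
    qed
    ultimately show ?thesis
      using V(1) K(1,3) lin_r
      by (intro exI[of _ "V \<union> u ` {..<r0}"] exI[of _ "H0 \<union> K"]) (auto simp: H0_def)
  qed
qed

text \<open>
  Up to \<open>2 * r\<close> conditions on \<open>w\<close>, the slices \<open>\<lambda>x w. t x u w\<close> vanish as soon as \<open>2 * r\<close> of them do, and
  each of these has a kernel of codimension at most \<open>k\<close>.
\<close>

lemma degenerate_of_small_slice_ranks:
  assumes left: "\<And>u w. lin (\<lambda>x. t x u w)" and bil: "\<And>x. bilin (t x)"
    and r: "\<And>x u w. \<not> dual_system (t x) UNIV UNIV (Suc r) u w"
    and k: "\<And>u x w. \<not> dual_system (\<lambda>x. t x u) UNIV UNIV (Suc k) x w"
    and "2 * r * Suc k < n"
  shows "\<exists>w. (\<exists>i<n. w i \<noteq> 0) \<and> (\<forall>x u. t x u w = 0)"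
proof -
  have lin_r: "lin (t x u)" for x u
    using bilin_right[OF bil] .
  have zeros_empty: "zeros ({} :: ((nat \<Rightarrow> 'a) \<Rightarrow> 'a) set) = UNIV" by (simp add: zeros_def)
  have "\<not> dual_system (t x) (zeros ({} :: ((nat \<Rightarrow> 'a) \<Rightarrow> 'a) set))
          (zeros ({} :: ((nat \<Rightarrow> 'a) \<Rightarrow> 'a) set)) (Suc r) u w" for x u w
    unfolding zeros_empty by (rule r)
  from slices_vanish_of_small_rank[OF left bil _ _ this] obtain V K where V: "finite V" "card V \<le> 2 * r" and K: "finite K" "card K \<le> 2 * r" "\<forall>g\<in>K. lin g"
    and VK: "\<forall>w\<in>zeros K. \<forall>x. (\<forall>v\<in>V. t x v w = 0) \<longrightarrow> (\<forall>u. t x u w = 0)"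
    unfolding zeros_empty by auto
  have "bilin (\<lambda>x. t x u)" for u
    using left lin_r unfolding bilin_def by blast
  from kernel_of_small_rank[OF this k] obtain L where L: "finite (L u)" "card (L u) \<le> k"
    "\<forall>g\<in>L u. lin g" "\<forall>z\<in>zeros (L u). \<forall>x. t x u z = 0" for u
    by metis
  have "card (\<Union>v\<in>V. L v) \<le> (\<Sum>v\<in>V. card (L v))"
    by (rule card_UN_le[OF V(1)])
  also have "\<dots> \<le> card V * k"
    using sum_bounded_above[of V "\<lambda>v. card (L v)" k] L(2) by simp
  also have "\<dots> \<le> 2 * r * k"
    using V(2) by simp
  \<comment> \<open>\<open>K\<close> contributes \<open>2 * r\<close> conditions and the kernels
    \<open>2 * r * k\<close>, together at most \<open>2 * r * Suc k\<close>.\<close>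
  finally have "card (K \<union> (\<Union>v\<in>V. L v)) < n"
    using card_Un_le[of K "\<Union>v\<in>V. L v"] K(2) assms(5) by simp
  moreover have "finite (K \<union> (\<Union>v\<in>V. L v))" using K(1) V(1) L(1) by blast
  moreover have "lin g" if "g \<in> K \<union> (\<Union>v\<in>V. L v)" for g using that K(3) L(3) by blast
  ultimately obtain w where w: "\<exists>i<n. w i \<noteq> 0" "\<forall>g\<in>K \<union> (\<Union>v\<in>V. L v). g w = 0"
    using common_zero[of "K \<union> (\<Union>v\<in>V. L v)" n] by blast
  have "t x u w = 0" for x u
  proof -
    have "t x v w = 0" if "v \<in> V" for v
    proof -
      have "w \<in> zeros (L v)" using w(2) that by (intro zerosI) blast
      then show ?thesis using L(4) by blast
    qed
    moreover have "w \<in> zeros K" using w(2) by (intro zerosI) blast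
    ultimately show ?thesis using VK by blast
  qed
  then show ?thesis using w(1) by blast
qed

subsection \<open>Tensors as trilinear forms\<close>

lemma dual_systemD:
  "dual_system b P Q k u w \<Longrightarrow> i < k \<Longrightarrow> j < k \<Longrightarrow> b (u i) (w j) = (if i = j then 1 else 0)"
  unfolding dual_system_def by blast

lemma dual_system_flip: "dual_system b P Q k u w \<longleftrightarrow> dual_system (\<lambda>w u. b u w) Q P k w u"
  unfolding dual_system_def by auto

text \<open>Evaluated at rows of matrices it gives the entries of \<open>tensor3_map\<close>; with
  one argument fixed it is a matrix in the span of the slices.\<close>

definition tensor_form :: "nat \<Rightarrow> nat \<Rightarrow> nat \<Rightarrow> 'a::field tensor3 \<Rightarrow> (nat \<Rightarrow> 'a) \<Rightarrow> (nat \<Rightarrow> 'a) \<Rightarrow> (nat \<Rightarrow> 'a) \<Rightarrow> 'a" where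
  "tensor_form n1 n2 n3 T x u w = (\<Sum>i<n1. \<Sum>j<n2. \<Sum>k<n3. x i * u j * w k * T i j k)"

lemma lin_tensor_form:
  shows lin_tensor_form1: "lin (\<lambda>x. tensor_form n1 n2 n3 T x u w)"
    and lin_tensor_form2: "lin (\<lambda>u. tensor_form n1 n2 n3 T x u w)"
    and lin_tensor_form3: "lin (\<lambda>w. tensor_form n1 n2 n3 T x u w)"
  unfolding lin_def tensor_form_def sum_distrib_left sum.distrib[symmetric]
  by (intro allI sum.cong; simp add: algebra_simps)+

lemma sum_unit:
  assumes "i < (n::nat)"
  shows "(\<Sum>s<n. (if s = i then 1 else 0) * f s) = (f i :: 'a::field)"
proof -
  have "(\<Sum>s<n. (if s = i then 1 else 0) * f s) = (\<Sum>s<n. if s = i then f s else 0)"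
    by (intro sum.cong) auto
  then show ?thesis using assms by simp
qed

section \<open>Restrictions to unit tensors and the subrank\<close>

lemma restricts_to_unit_iff:
  "restricts_to_unit n1 n2 n3 T r \<longleftrightarrow>
     (\<exists>x u w. \<forall>a<r. \<forall>b<r. \<forall>c<r. tensor_form n1 n2 n3 T (x a) (u b) (w c) = (if a = b \<and> b = c then 1 else 0))"
proof
  assume "restricts_to_unit n1 n2 n3 T r"
  then obtain L1 L2 L3 where L: "L1 \<in> carrier_mat r n1" "L2 \<in> carrier_mat r n2" "L3 \<in> carrier_mat r n3"
    and eq: "tensor3_map L1 L2 L3 T = unit_tensor3 r"
    unfolding restricts_to_unit_def by blast
  have eq': "tensor_form n1 n2 n3 T (\<lambda>i. L1 $$ (a, i)) (\<lambda>j. L2 $$ (b, j)) (\<lambda>k. L3 $$ (c, k)) = (if a = b \<and> b = c then 1 else 0)"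
    if "a < r" "b < r" "c < r" for a b c
    using fun_cong[OF fun_cong[OF fun_cong[OF eq, of a], of b], of c] L that
    by (simp add: tensor3_map_def tensor_form_def unit_tensor3_def)
  then show "\<exists>x u w. \<forall>a<r. \<forall>b<r. \<forall>c<r. tensor_form n1 n2 n3 T (x a) (u b) (w c) = (if a = b \<and> b = c then 1 else 0)"
    by (intro exI[of _ "\<lambda>a i. L1 $$ (a, i)"] exI[of _ "\<lambda>b j. L2 $$ (b, j)"] exI[of _ "\<lambda>c k. L3 $$ (c, k)"]
        allI impI eq')
next
  assume "\<exists>x u w. \<forall>a<r. \<forall>b<r. \<forall>c<r. tensor_form n1 n2 n3 T (x a) (u b) (w c) = (if a = b \<and> b = c then 1 else 0)"
  then obtain x u w where eq: "\<And>a b c. a < r \<Longrightarrow> b < r \<Longrightarrow> c < r \<Longrightarrow>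
      tensor_form n1 n2 n3 T (x a) (u b) (w c) = (if a = b \<and> b = c then 1 else 0)"
    by blast
  let ?L = "\<lambda>n x. mat r n (\<lambda>(a, i). x a i)"
  have "tensor3_map (?L n1 x) (?L n2 u) (?L n3 w) T a b c = unit_tensor3 r a b c" for a b c
  proof (cases "a < r \<and> b < r \<and> c < r")
    case True
    then have "tensor3_map (?L n1 x) (?L n2 u) (?L n3 w) T a b c = tensor_form n1 n2 n3 T (x a) (u b) (w c)"
      by (simp add: tensor3_map_def tensor_form_def)
    then show ?thesis using True eq[of a b c] by (simp add: unit_tensor3_def)
  next
    case False
    moreover from False have "\<not> (a < r \<and> a = b \<and> b = c)" by metis
    ultimately show ?thesis
      unfolding tensor3_map_def unit_tensor3_def dim_row_mat by (simp only: if_False)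
  qed
  then have "tensor3_map (?L n1 x) (?L n2 u) (?L n3 w) T = unit_tensor3 r"
    by blast
  moreover have "?L n x \<in> carrier_mat r n" for n and x :: "nat \<Rightarrow> nat \<Rightarrow> 'a"
    by simp
  ultimately show "restricts_to_unit n1 n2 n3 T r"
    unfolding restricts_to_unit_def by blast
qed

lemma restricts_to_unitI:
  assumes "\<And>a b c. a < r \<Longrightarrow> b < r \<Longrightarrow> c < r \<Longrightarrow>
    tensor_form n1 n2 n3 T (x a) (u b) (w c) = (if a = b \<and> b = c then 1 else 0)"
  shows "restricts_to_unit n1 n2 n3 T r"
  unfolding restricts_to_unit_iff
  by (rule exI[of _ x], rule exI[of _ u], rule exI[of _ w]) (simp add: assms)

text \<open>More than \<open>n1\<close> vectors \<open>x a\<close> satisfy a nontrivial relation on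
  their first \<open>n1\<close> coordinates; pairing it with \<open>u b\<close> and
  \<open>w b\<close> isolates its \<open>b\<close>-th coefficient.\<close>

lemma restricts_to_unit_le:
  assumes "restricts_to_unit n1 n2 n3 T r"
  shows "r \<le> n1"
proof (rule ccontr)
  assume "\<not> r \<le> n1"
  obtain x u w where eq: "\<And>a b c. a < r \<Longrightarrow> b < r \<Longrightarrow> c < r \<Longrightarrow>
      tensor_form n1 n2 n3 T (x a) (u b) (w c) = (if a = b \<and> b = c then 1 else 0)"
    using assms unfolding restricts_to_unit_iff by blast
  define G where "G = (\<lambda>i \<alpha>. \<Sum>a<r. x a i * \<alpha> a) ` {..<n1}"
  have "card G < r"
    using card_image_le[of "{..<n1}" "\<lambda>i \<alpha>. \<Sum>a<r. x a i * \<alpha> a"] \<open>\<not> r \<le> n1\<close> unfolding G_def by simp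
  moreover have "lin g" if "g \<in> G" for g
    using that by (auto simp: G_def intro: lin_coord_sum)
  moreover have "finite G" unfolding G_def by blast
  ultimately obtain \<alpha> where \<alpha>: "\<exists>a<r. \<alpha> a \<noteq> 0" "\<forall>g\<in>G. g \<alpha> = 0"
    using common_zero[of G r] by blast
  from \<alpha>(1) obtain b where b: "b < r" "\<alpha> b \<noteq> 0" by blast
  have "(\<Sum>a<r. \<alpha> a * x a i) = 0" if "i < n1" for i
    using \<alpha>(2) that unfolding G_def by (simp add: mult.commute)
  then have "tensor_form n1 n2 n3 T (\<lambda>i. \<Sum>a<r. \<alpha> a * x a i) (u b) (w b) = 0"
    unfolding tensor_form_def by (intro sum.neutral ballI) simp
  moreover have "tensor_form n1 n2 n3 T (\<lambda>i. \<Sum>a<r. \<alpha> a * x a i) (u b) (w b) = (\<Sum>a<r. \<alpha> a * (if a = b then 1 else 0))"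
    unfolding lin_sum[OF lin_tensor_form1] using b(1) eq by (intro sum.cong) auto
  moreover have "(\<Sum>a<r. \<alpha> a * (if a = b then 1 else 0)) = \<alpha> b"
    using sum_unit[OF b(1), of \<alpha>] by (simp add: mult.commute)
  ultimately show False using b(2) by simp
qed

lemma restricts_to_unit_0: "restricts_to_unit n1 n2 n3 T 0"
  unfolding restricts_to_unit_iff by simp

lemma le_subrank: "restricts_to_unit n1 n2 n3 T r \<Longrightarrow> r \<le> subrank n1 n2 n3 T"
  unfolding subrank_def using restricts_to_unit_le by (metis Greatest_le_nat)

lemma restricts_to_unit_subrank: "restricts_to_unit n1 n2 n3 T (subrank n1 n2 n3 T)"
  unfolding subrank_def using restricts_to_unit_le restricts_to_unit_0 by (metis GreatestI_nat)

lemma subrank_le: "subrank n1 n2 n3 T \<le> n1"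
  using restricts_to_unit_le[OF restricts_to_unit_subrank] .

section \<open>Kronecker products and powers\<close>

lemma sum_div_mod:
  "(\<Sum>k<n*m. f (k div m) (k mod m)) = (\<Sum>a<n. \<Sum>b<m::nat. f a b)"
  unfolding sum.cartesian_product
proof (rule sum.reindex_bij_witness[of _ "\<lambda>(a, b). a * m + b" "\<lambda>k. (k div m, k mod m)"])
  fix p assume "p \<in> {..<n} \<times> {..<m}"
  then obtain a b where p: "p = (a, b)" "a < n" "b < m" by blast
  then have "Suc a * m \<le> n * m" by (intro mult_le_mono1) simp
  then show "(case p of (a, b) \<Rightarrow> a * m + b) \<in> {..<n * m}" using p by simp
qed (auto simp: less_mult_imp_div_less intro!: mod_less_divisor gr0I)

text \<open>Indices are split as in \<open>kron3\<close>, so that the form of a Kronecker product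
  factorises on these vectors.\<close>

definition kron_vec :: "nat \<Rightarrow> (nat \<Rightarrow> 'a::field) \<Rightarrow> (nat \<Rightarrow> 'a) \<Rightarrow> nat \<Rightarrow> 'a" where
  "kron_vec m x y = (\<lambda>i. x (i div m) * y (i mod m))"

lemma tensor_form_kron3:
  "tensor_form (n1 * m1) (n2 * m2) (n3 * m3) (kron3 m1 m2 m3 S T) (kron_vec m1 x x') (kron_vec m2 u u') (kron_vec m3 w w')
   = tensor_form n1 n2 n3 S x u w * tensor_form m1 m2 m3 T x' u' w'"
proof -
  define F where "F i i' j j' k k' = (x i * u j * w k * S i j k) * (x' i' * u' j' * w' k' * T i' j' k')"
    for i i' j j' k k'
  have "tensor_form (n1 * m1) (n2 * m2) (n3 * m3) (kron3 m1 m2 m3 S T) (kron_vec m1 x x') (kron_vec m2 u u') (kron_vec m3 w w')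
      = (\<Sum>i<n1 * m1. \<Sum>j<n2 * m2. \<Sum>k<n3 * m3.
           F (i div m1) (i mod m1) (j div m2) (j mod m2) (k div m3) (k mod m3))"
    unfolding tensor_form_def kron_vec_def kron3_def F_def by (intro sum.cong refl) (simp add: mult_ac)
  also have "\<dots> = (\<Sum>i<n1 * m1. \<Sum>j<n2 * m2. \<Sum>k<n3. \<Sum>k'<m3.
           F (i div m1) (i mod m1) (j div m2) (j mod m2) k k')"
    by (intro sum.cong refl sum_div_mod)
  also have "\<dots> = (\<Sum>i<n1 * m1. \<Sum>j<n2. \<Sum>j'<m2. \<Sum>k<n3. \<Sum>k'<m3. F (i div m1) (i mod m1) j j' k k')"
    by (intro sum.cong refl sum_div_mod[of "\<lambda>j j'. \<Sum>k<n3. \<Sum>k'<m3. F (_ div m1) (_ mod m1) j j' k k'"])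
  also have "\<dots> = (\<Sum>i<n1. \<Sum>i'<m1. \<Sum>j<n2. \<Sum>j'<m2. \<Sum>k<n3. \<Sum>k'<m3. F i i' j j' k k')"
    by (rule sum_div_mod)
  also have "\<dots> = tensor_form n1 n2 n3 S x u w * tensor_form m1 m2 m3 T x' u' w'"
    unfolding tensor_form_def F_def sum_product ..
  finally show ?thesis .
qed

text \<open>Kronecker products of the rows work, indexed by quotient and remainder modulo
  \<open>s\<close>: two indices agree exactly when both parts do.\<close>

lemma restricts_to_unit_kron3:
  assumes "restricts_to_unit n1 n2 n3 S r" "restricts_to_unit m1 m2 m3 T s"
  shows "restricts_to_unit (n1 * m1) (n2 * m2) (n3 * m3) (kron3 m1 m2 m3 S T) (r * s)"
proof -
  obtain x u w where S: "\<And>a b c. a < r \<Longrightarrow> b < r \<Longrightarrow> c < r \<Longrightarrow>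
      tensor_form n1 n2 n3 S (x a) (u b) (w c) = (if a = b \<and> b = c then 1 else 0)"
    using assms(1) unfolding restricts_to_unit_iff by blast
  obtain x' u' w' where T: "\<And>a b c. a < s \<Longrightarrow> b < s \<Longrightarrow> c < s \<Longrightarrow>
      tensor_form m1 m2 m3 T (x' a) (u' b) (w' c) = (if a = b \<and> b = c then 1 else 0)"
    using assms(2) unfolding restricts_to_unit_iff by blast
  have eq: "a = b \<longleftrightarrow> a div s = b div s \<and> a mod s = b mod s" for a b :: nat
    by (metis mult_div_mod_eq)
  have "tensor_form (n1 * m1) (n2 * m2) (n3 * m3) (kron3 m1 m2 m3 S T)
          (kron_vec m1 (x (a div s)) (x' (a mod s))) (kron_vec m2 (u (b div s)) (u' (b mod s)))
          (kron_vec m3 (w (c div s)) (w' (c mod s))) = (if a = b \<and> b = c then 1 else 0)"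
    if "a < r * s" "b < r * s" "c < r * s" for a b c
  proof -
    have "s > 0" using that(1) by (cases s) auto
    then show ?thesis
      using that by (simp add: tensor_form_kron3 S T less_mult_imp_div_less eq[of a b] eq[of b c])
  qed
  then show ?thesis
    by (rule restricts_to_unitI[where x = "\<lambda>a. kron_vec m1 (x (a div s)) (x' (a mod s))"
          and u = "\<lambda>b. kron_vec m2 (u (b div s)) (u' (b mod s))" and w = "\<lambda>c. kron_vec m3 (w (c div s)) (w' (c mod s))"])
qed

lemma kron3_power_add:
  "kron3_power n1 n2 n3 T (m + k) =
     kron3 (n1 ^ k) (n2 ^ k) (n3 ^ k) (kron3_power n1 n2 n3 T m) (kron3_power n1 n2 n3 T k)"
proof (induction k)
  case 0
  show ?case by (simp add: kron3_def unit_tensor3_def fun_eq_iff)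
next
  case (Suc k)
  \<comment> \<open>Splitting off the last factor commutes with splitting off a block of factors;
    \<open>n = 0\<close> is covered by the conventions for division by 0.\<close>
  have *: "(i mod (n * N)) div n = (i div n) mod N" "i div (n * N) = i div n div N"
     "i mod (n * N) mod n = i mod n" for i n N :: nat
    by (cases "n = 0"; simp add: mod_mult2_eq div_mult2_eq mod_mod_cancel)+
  show ?case
    by (simp add: Suc kron3_def fun_eq_iff * mult.assoc)
qed

section \<open>Conciseness as linear independence of slices\<close>

lemma (in vec_space) left_kernel_of_full_row_rank:
  assumes A: "A \<in> carrier_mat n nc" and "rank A = n"
    and w: "\<And>j. j < nc \<Longrightarrow> (\<Sum>k<n. w k * A $$ (k, j)) = 0" and "k < n"
  shows "w k = 0"
proof -
  have "lin_indpt {}" unfolding lin_dep_def by blast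
  \<comment> \<open>A maximal independent set of columns has \<open>n\<close> elements and forms an
    invertible \<open>B\<close>. Since \<open>w\<close> annihilates every column of
    \<open>A\<close>, it lies in the kernel of the transpose of \<open>B\<close>.\<close>
  then obtain S where S: "maximal S (\<lambda>T. T \<subseteq> set (cols A) \<and> lin_indpt T)"
    using maximal_exists_superset[of "set (cols A)" "\<lambda>T. T \<subseteq> set (cols A) \<and> lin_indpt T" "{}"] by blast
  have S': "S \<subseteq> set (cols A)" "lin_indpt S" using S unfolding maximal_def by blast+
  have card: "card S = n" using rank_card_indpt[OF A S] assms(2) by simp
  obtain xs where xs: "set xs = S" "distinct xs"
    using finite_distinct_list[of S] finite_subset[OF S'(1)] by blast
  have len: "length xs = n" using distinct_card[OF xs(2)] xs(1) card by simp
  have dim: "set xs \<subseteq> carrier_vec n" using xs(1) S'(1) cols_dim[of A] A by auto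
  define B where "B = mat_of_cols n xs"
  have B: "B \<in> carrier_mat n n" unfolding B_def using len by auto
  have cols: "cols B = xs" unfolding B_def by (rule cols_mat_of_cols[OF dim])
  have "rank B = n" by (rule lin_indpt_full_rank[OF B]) (simp_all add: cols xs S')
  then have det: "det (transpose_mat B) \<noteq> 0" using det_rank_iff[OF B] det_transpose[OF B] by simp
  have "transpose_mat B *\<^sub>v vec n w = 0\<^sub>v n"
  proof (rule eq_vecI)
    fix i assume i: "i < dim_vec (0\<^sub>v n :: 'a vec)"
    then have "xs ! i \<in> set (cols A)" using len xs(1) S'(1) by auto
    then obtain j where j: "j < nc" "xs ! i = col A j"
      using A by (auto simp: cols_def)
    have "(transpose_mat B *\<^sub>v vec n w) $ i = col B i \<bullet> vec n w"
      using i B by simp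
    also have "col B i = col A j"
      using cols i B j(2) len by (metis carrier_matD(2) cols_nth index_zero_vec(2))
    also have "col A j \<bullet> vec n w = (\<Sum>k<n. w k * A $$ (k, j))"
      using A j(1) by (auto simp: scalar_prod_def mult.commute atLeast0LessThan intro!: sum.cong)
    finally show "(transpose_mat B *\<^sub>v vec n w) $ i = 0\<^sub>v n $ i"
      using w[OF j(1)] i by simp
  qed (use B in auto)
  moreover have "transpose_mat B \<in> carrier_mat n n" using B by simp
  ultimately have "vec n w = 0\<^sub>v n"
    using det_0_iff_vec_prod_zero_field[of "transpose_mat B" n] det by (metis vec_carrier)
  then show ?thesis using \<open>k < n\<close> by (metis index_vec index_zero_vec(1))
qed

text \<open>Conciseness is used in this form because it passes to Kronecker products without rank
  computations.\<close>

definition indep_slices :: "nat \<Rightarrow> nat \<Rightarrow> nat \<Rightarrow> 'a::field tensor3 \<Rightarrow> bool" where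
  "indep_slices n p q A \<longleftrightarrow>
     (\<forall>w. (\<forall>i<p. \<forall>j<q. (\<Sum>k<n. w k * A k i j) = 0) \<longrightarrow> (\<forall>k<n. w k = 0))"

lemma indep_slicesD:
  assumes "indep_slices n p q A" "\<And>i j. i < p \<Longrightarrow> j < q \<Longrightarrow> (\<Sum>k<n. w k * A k i j) = 0" "k < n"
  shows "w k = 0"
  using assms(1)[unfolded indep_slices_def, rule_format, of w k] assms(2,3) by simp

lemma indep_slices_of_full_rank:
  assumes "vec_space.rank n (mat n (p * q) (\<lambda>(k, s). A k (s div q) (s mod q))) = n"
  shows "indep_slices n p q A"
  unfolding indep_slices_def
proof (intro allI impI)
  fix w k assume w: "\<forall>i<p. \<forall>j<q. (\<Sum>k<n. w k * A k i j) = 0" and "k < n"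
  show "w k = 0"
  proof (rule vec_space.left_kernel_of_full_row_rank[OF _ assms _ \<open>k < n\<close>])
    fix s assume s: "s < p * q"
    then have "s div q < p" "s mod q < q"
      by (auto simp: less_mult_imp_div_less intro!: mod_less_divisor gr0I)
    then show "(\<Sum>k<n. w k * mat n (p * q) (\<lambda>(k, s). A k (s div q) (s mod q)) $$ (k, s)) = 0"
      using w s by simp
  qed simp
qed

lemma indep_slices_kron3:
  assumes S: "indep_slices n p q S" and T: "indep_slices n' p' q' T"
  shows "indep_slices (n * n') (p * p') (q * q') (kron3 n' p' q' S T)"
  unfolding indep_slices_def
proof (intro allI impI)
  fix w K
  assume w: "\<forall>I<p * p'. \<forall>J<q * q'. (\<Sum>K<n * n'. w K * kron3 n' p' q' S T K I J) = 0" and K: "K < n * n'"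
  \<comment> \<open>For fixed \<open>i'\<close> and \<open>j'\<close> the inner sums are the
    coefficients of a relation between the slices of \<open>S\<close>, so they vanish; they in turn
    are relations between the slices of \<open>T\<close>.\<close>
  have inner: "(\<Sum>k'<n'. w (k * n' + k') * T k' i' j') = 0" if "k < n" "i' < p'" "j' < q'" for k i' j'
  proof -
    have "(\<Sum>k<n. (\<Sum>k'<n'. w (k * n' + k') * T k' i' j') * S k i j) = 0" if "i < p" "j < q" for i j
    proof -
      have "Suc i * p' \<le> p * p'" "Suc j * q' \<le> q * q'"
        using that by (intro mult_le_mono1; simp)+
      then have "i * p' + i' < p * p'" "j * q' + j' < q * q'"
        using \<open>i' < p'\<close> \<open>j' < q'\<close> by simp_all
      then have "0 = (\<Sum>K<n * n'. w K * kron3 n' p' q' S T K (i * p' + i') (j * q' + j'))"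
        using w by simp
      also have "\<dots> = (\<Sum>K<n * n'. w ((K div n') * n' + K mod n') * (S (K div n') i j * T (K mod n') i' j'))"
        using \<open>i' < p'\<close> \<open>j' < q'\<close> by (simp add: kron3_def)
      also have "\<dots> = (\<Sum>k<n. \<Sum>k'<n'. w (k * n' + k') * (S k i j * T k' i' j'))"
        by (rule sum_div_mod)
      finally show ?thesis
        by (simp add: sum_distrib_left sum_distrib_right mult_ac)
    qed
    from indep_slicesD[OF S this that(1)] show ?thesis by simp
  qed
  have "n' > 0" using K by (cases n') auto
  then have "K div n' < n" "K mod n' < n'" using K by (simp_all add: less_mult_imp_div_less)
  from indep_slicesD[OF T inner[OF this(1)] this(2)] show "w K = 0" by simp
qed

text \<open>The index orders are those of the three flattenings.\<close>

definition indep_slices3 :: "nat \<Rightarrow> nat \<Rightarrow> nat \<Rightarrow> 'a::field tensor3 \<Rightarrow> bool" where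
  "indep_slices3 n1 n2 n3 T \<longleftrightarrow> indep_slices n1 n2 n3 T \<and>
     indep_slices n2 n1 n3 (\<lambda>j i k. T i j k) \<and> indep_slices n3 n1 n2 (\<lambda>k i j. T i j k)"

lemma indep_slices3_of_concise: "concise n1 n2 n3 T \<Longrightarrow> indep_slices3 n1 n2 n3 T"
  unfolding concise_def flattening1_def flattening2_def flattening3_def indep_slices3_def
  by (auto intro!: indep_slices_of_full_rank)

lemma indep_slices3_kron3:
  assumes "indep_slices3 n1 n2 n3 S" "indep_slices3 m1 m2 m3 T"
  shows "indep_slices3 (n1 * m1) (n2 * m2) (n3 * m3) (kron3 m1 m2 m3 S T)"
proof -
  have "(\<lambda>j i k. kron3 m1 m2 m3 S T i j k) = kron3 m2 m1 m3 (\<lambda>j i k. S i j k) (\<lambda>j i k. T i j k)"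
    "(\<lambda>k i j. kron3 m1 m2 m3 S T i j k) = kron3 m3 m1 m2 (\<lambda>k i j. S i j k) (\<lambda>k i j. T i j k)"
    by (simp_all add: kron3_def)
  then show ?thesis
    using assms indep_slices_kron3 unfolding indep_slices3_def by metis
qed

lemma indep_slices3_kron3_power:
  assumes "indep_slices3 n1 n2 n3 T"
  shows "indep_slices3 (n1 ^ m) (n2 ^ m) (n3 ^ m) (kron3_power n1 n2 n3 T m)"
proof (induction m)
  case 0
  show ?case by (simp add: indep_slices3_def indep_slices_def unit_tensor3_def)
next
  case (Suc m)
  then show ?case using indep_slices3_kron3[OF Suc assms] by (simp add: mult.commute)
qed

lemma tensor_form_slice_eq_0:
  assumes "i < n1" "j < n2"
  shows "tensor_form n1 n2 n3 T (\<lambda>s. if s = i then 1 else 0) (\<lambda>s. if s = j then 1 else 0) w = (\<Sum>k<n3. w k * T i j k)"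
proof -
  have "tensor_form n1 n2 n3 T x u w = (\<Sum>s<n1. x s * (\<Sum>t<n2. u t * (\<Sum>k<n3. w k * T s t k)))" for x u
    unfolding tensor_form_def by (simp add: sum_distrib_left mult.assoc)
  then show ?thesis
    by (simp only: sum_unit[OF assms(1)] sum_unit[OF assms(2)])
qed

lemma tensor_form_swap12: "tensor_form n1 n2 n3 T x u w = tensor_form n2 n1 n3 (\<lambda>j i k. T i j k) u x w"
  unfolding tensor_form_def by (subst sum.swap) (simp add: mult_ac)

lemma tensor_form_swap23: "tensor_form n1 n2 n3 T x u w = tensor_form n1 n3 n2 (\<lambda>i k j. T i j k) x w u"
  unfolding tensor_form_def by (rule sum.cong[OF refl], rule trans[OF sum.swap]) (simp add: mult_ac)

lemma indep_slices_tensor_form: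
  assumes "indep_slices n3 n1 n2 (\<lambda>k i j. T i j k)" "\<And>x u. tensor_form n1 n2 n3 T x u w = 0" "k < n3"
  shows "w k = 0"
proof -
  have "(\<Sum>k<n3. w k * T i j k) = 0" if "i < n1" "j < n2" for i j
    using assms(2) tensor_form_slice_eq_0[OF that] by metis
  from indep_slicesD[OF assms(1) this assms(3)] show ?thesis by simp
qed

section \<open>Slices of large rank and the subrank of the square\<close>

lemma two_large_slice_ranks:
  assumes T: "indep_slices3 n1 n2 n3 T" and s: "2 * s * Suc s < min n1 (min n2 n3)"
  defines "t \<equiv> tensor_form n1 n2 n3 T"
  defines "D1 \<equiv> \<exists>x u w. dual_system (t x) UNIV UNIV (Suc s) u w"
    and "D2 \<equiv> \<exists>u x w. dual_system (\<lambda>x. t x u) UNIV UNIV (Suc s) x w"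
    and "D3 \<equiv> \<exists>w x u. dual_system (\<lambda>x u. t x u w) UNIV UNIV (Suc s) x u"
  shows "D1 \<and> D2 \<or> D1 \<and> D3 \<or> D2 \<and> D3"
proof -
  have l: "lin (\<lambda>x. t x u w)" "lin (\<lambda>u. t x u w)" "lin (\<lambda>w. t x u w)" for x u w
    unfolding t_def by (rule lin_tensor_form)+
  \<comment> \<open>If both directions had rank at most \<open>s\<close>, a nonzero vector in the
    third would annihilate \<open>T\<close>, against independence. One large direction in every pair
    makes at least two.\<close>
  have "D1 \<or> D2"
  proof (rule ccontr)
    assume "\<not> (D1 \<or> D2)"
    then obtain w where w: "\<exists>i<n3. w i \<noteq> 0" "\<forall>x u. t x u w = 0"
      using degenerate_of_small_slice_ranks[of t s s n3] l s unfolding D1_def D2_def bilin_def by auto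
    have "indep_slices n3 n1 n2 (\<lambda>k i j. T i j k)" using T unfolding indep_slices3_def by blast
    from indep_slices_tensor_form[OF this] w show False unfolding t_def by blast
  qed
  moreover have "D1 \<or> D3"
  proof (rule ccontr)
    assume "\<not> (D1 \<or> D3)"
    then have "\<not> dual_system (\<lambda>w u. t x u w) UNIV UNIV (Suc s) q p"
      "\<not> dual_system (\<lambda>x u. t x u w) UNIV UNIV (Suc s) p q" for x w p q
      unfolding D1_def D3_def dual_system_flip[of "\<lambda>w u. t x u w"] by blast+
    \<comment> \<open>The arguments are permuted so that the direction of the degenerate vector
      comes last.\<close>
    then obtain u where u: "\<exists>i<n2. u i \<noteq> 0" "\<forall>x w. t x u w = 0"
      using degenerate_of_small_slice_ranks[of "\<lambda>x w u. t x u w" s s n2] l s unfolding bilin_def by auto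
    have "indep_slices n2 n1 n3 (\<lambda>j i k. T i j k)" using T unfolding indep_slices3_def by blast
    from indep_slices_tensor_form[of n2 n1 n3 "\<lambda>i k j. T i j k", OF this] u show False
      unfolding t_def tensor_form_swap23[of n1 n2 n3 T] by blast
  qed
  moreover have "D2 \<or> D3"
  proof (rule ccontr)
    assume "\<not> (D2 \<or> D3)"
    then have "\<not> dual_system (\<lambda>w x. t x u w) UNIV UNIV (Suc s) q p"
      "\<not> dual_system (\<lambda>u x. t x u w) UNIV UNIV (Suc s) q p" for u w p q
      unfolding D2_def D3_def dual_system_flip[of "\<lambda>w x. t x u w"] dual_system_flip[of "\<lambda>u x. t x u w"]
      by blast+
    then obtain x where x: "\<exists>i<n1. x i \<noteq> 0" "\<forall>u w. t x u w = 0"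
      using degenerate_of_small_slice_ranks[of "\<lambda>u w x. t x u w" s s n1] l s unfolding bilin_def by auto
    have "indep_slices n1 n2 n3 (\<lambda>i j k. T i j k)" using T unfolding indep_slices3_def by blast
    from indep_slices_tensor_form[of n1 n2 n3 "\<lambda>j k i. T i j k", OF this] x show False
      unfolding t_def tensor_form_swap12[of n1 n2 n3 T] tensor_form_swap23[of n2 n1 n3] by blast
  qed
  ultimately show ?thesis by blast
qed

text \<open>
  Slices of rank \<open>r\<close> in two different directions are restrictions of \<open>T\<close> to matrices
  \<open>\<Sum> e\<^sub>0 \<otimes> e\<^sub>i \<otimes> e\<^sub>i\<close> and, say, \<open>\<Sum> e\<^sub>i \<otimes> e\<^sub>0 \<otimes> e\<^sub>i\<close>; the Kronecker product of these two contains
  the diagonal of size \<open>r\<close>.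
\<close>

lemma restricts_to_unit_kron3_square:
  assumes T: "indep_slices3 n1 n2 n3 T" and s: "2 * s * Suc s < min n1 (min n2 n3)"
  shows "restricts_to_unit (n1 * n1) (n2 * n2) (n3 * n3) (kron3 n1 n2 n3 T T) (Suc s)"
proof -
  let ?t = "tensor_form n1 n2 n3 T"
  define r where "r = Suc s"
  let ?R = "\<exists>x u w x' u' w'. \<forall>a<r. \<forall>b<r. \<forall>c<r.
     ?t (x a) (u b) (w c) * ?t (x' a) (u' b) (w' c) = (if a = b \<and> b = c then 1 else 0)"
  consider
      "\<exists>x u w. dual_system (?t x) UNIV UNIV r u w" "\<exists>u x w. dual_system (\<lambda>x. ?t x u) UNIV UNIV r x w"
    | "\<exists>x u w. dual_system (?t x) UNIV UNIV r u w" "\<exists>w x u. dual_system (\<lambda>x u. ?t x u w) UNIV UNIV r x u"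
    | "\<exists>u x w. dual_system (\<lambda>x. ?t x u) UNIV UNIV r x w" "\<exists>w x u. dual_system (\<lambda>x u. ?t x u w) UNIV UNIV r x u"
    using two_large_slice_ranks[OF T s] unfolding r_def by blast
  \<comment> \<open>The direction of each slice receives a constant vector; two deltas such as
    \<open>b = c\<close> and \<open>a = c\<close> multiply to the three-index delta.\<close>
  then have ?R
  proof cases
    case 1
    from 1(1) obtain x u w where d1: "dual_system (?t x) UNIV UNIV r u w" by blast
    from 1(2) obtain u' x' w' where d2: "dual_system (\<lambda>x. ?t x u') UNIV UNIV r x' w'" by blast
    show ?thesis
      by (rule exI[of _ "\<lambda>_. x"], rule exI[of _ u], rule exI[of _ w],
        rule exI[of _ x'], rule exI[of _ "\<lambda>_. u'"], rule exI[of _ w'], intro allI impI)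
        (simp add: dual_systemD[OF d1] dual_systemD[OF d2])
  next
    case 2
    from 2(1) obtain x u w where d1: "dual_system (?t x) UNIV UNIV r u w" by blast
    from 2(2) obtain w' x' u' where d2: "dual_system (\<lambda>x u. ?t x u w') UNIV UNIV r x' u'" by blast
    show ?thesis
      by (rule exI[of _ "\<lambda>_. x"], rule exI[of _ u], rule exI[of _ w],
        rule exI[of _ x'], rule exI[of _ u'], rule exI[of _ "\<lambda>_. w'"], intro allI impI)
        (simp add: dual_systemD[OF d1] dual_systemD[OF d2])
  next
    case 3
    from 3(1) obtain u x w where d1: "dual_system (\<lambda>x. ?t x u) UNIV UNIV r x w" by blast
    from 3(2) obtain w' x' u' where d2: "dual_system (\<lambda>x u. ?t x u w') UNIV UNIV r x' u'" by blast
    show ?thesis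
      by (rule exI[of _ x], rule exI[of _ "\<lambda>_. u"], rule exI[of _ w],
        rule exI[of _ x'], rule exI[of _ u'], rule exI[of _ "\<lambda>_. w'"], intro allI impI)
        (simp add: dual_systemD[OF d1] dual_systemD[OF d2])
  qed
  then obtain x u w x' u' w' where "\<forall>a<r. \<forall>b<r. \<forall>c<r.
     ?t (x a) (u b) (w c) * ?t (x' a) (u' b) (w' c) = (if a = b \<and> b = c then 1 else 0)" by blast
  then have "restricts_to_unit (n1 * n1) (n2 * n2) (n3 * n3) (kron3 n1 n2 n3 T T) r"
    by (intro restricts_to_unitI[where x = "\<lambda>a. kron_vec n1 (x a) (x' a)"
          and u = "\<lambda>b. kron_vec n2 (u b) (u' b)" and w = "\<lambda>c. kron_vec n3 (w c) (w' c)"])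
      (simp only: tensor_form_kron3)
  then show ?thesis unfolding r_def .
qed

text \<open>The lower bound of half the square root of the smallest dimension, squared to stay in
  the natural numbers.\<close>

lemma subrank_kron3_square_ge:
  assumes T: "indep_slices3 n1 n2 n3 T"
  shows "min n1 (min n2 n3) \<le> 4 * (subrank (n1 * n1) (n2 * n2) (n3 * n3) (kron3 n1 n2 n3 T T))\<^sup>2"
proof (cases "min n1 (min n2 n3) = 0")
  case False
  define N where "N = min n1 (min n2 n3)"
  define a where "a = (LEAST a. N \<le> 4 * a\<^sup>2)"
  have "N \<le> 4 * N\<^sup>2" by (simp add: power2_eq_square trans_le_add1)
  then have a: "N \<le> 4 * a\<^sup>2" unfolding a_def by (rule LeastI)
  then obtain s where s: "a = Suc s" using False by (cases a) (auto simp: N_def)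
  \<comment> \<open>By minimality of \<open>a\<close> its predecessor \<open>s\<close> violates the
    bound. As \<open>2 * s * Suc s \<le> 4 * s\<^sup>2\<close> holds also at 0, the size
    \<open>Suc s = a\<close> is attained.\<close>
  have "\<not> N \<le> 4 * s\<^sup>2" unfolding a_def[symmetric] using s not_less_Least[of s "\<lambda>a. N \<le> 4 * a\<^sup>2"] a_def by simp
  moreover have "2 * s * Suc s \<le> 4 * s\<^sup>2" by (cases s) (auto simp: power2_eq_square)
  ultimately have "2 * s * Suc s < min n1 (min n2 n3)" unfolding N_def[symmetric] by linarith
  from le_subrank[OF restricts_to_unit_kron3_square[OF T this]]
  have "a\<^sup>2 \<le> (subrank (n1 * n1) (n2 * n2) (n3 * n3) (kron3 n1 n2 n3 T T))\<^sup>2"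
    unfolding s by (rule power_mono) simp
  then show ?thesis using a unfolding N_def by linarith
qed simp

text \<open>Independence forces a nonzero value of the form, which rescales to 1. In the limit
  argument this bound allows leftover factors to be dropped.\<close>

lemma subrank_pos:
  assumes T: "indep_slices3 n1 n2 n3 T" and "n3 > 0"
  shows "subrank n1 n2 n3 T \<ge> 1"
proof -
  have "\<exists>x u w. tensor_form n1 n2 n3 T x u w \<noteq> 0"
  proof (rule ccontr)
    assume "\<not> ?thesis"
    moreover have "indep_slices n3 n1 n2 (\<lambda>k i j. T i j k)" using T unfolding indep_slices3_def by blast
    ultimately show False using indep_slices_tensor_form[of n3 n1 n2 T "\<lambda>_. 1" 0] \<open>n3 > 0\<close> by simp
  qed
  then obtain x u w where nz: "tensor_form n1 n2 n3 T x u w \<noteq> 0" by blast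
  have "tensor_form n1 n2 n3 T (\<lambda>i. inverse (tensor_form n1 n2 n3 T x u w) * x i) u w = 1"
    using lin_scale[OF lin_tensor_form1[of n1 n2 n3 T u w], of "inverse (tensor_form n1 n2 n3 T x u w)" x] nz by simp
  then have "restricts_to_unit n1 n2 n3 T 1"
    by (intro restricts_to_unitI[where x = "\<lambda>_ i. inverse (tensor_form n1 n2 n3 T x u w) * x i"
          and u = "\<lambda>_. u" and w = "\<lambda>_. w"]) simp
  then show ?thesis by (rule le_subrank)
qed

lemma subrank_eq_0:
  assumes "min n1 (min n2 n3) = 0"
  shows "subrank n1 n2 n3 T = 0"
proof (rule ccontr)
  assume "subrank n1 n2 n3 T \<noteq> 0"
  then obtain x u w where "tensor_form n1 n2 n3 T x u w = 1"
    using restricts_to_unit_subrank[of n1 n2 n3 T] unfolding restricts_to_unit_iff by (metis gr0I)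
  moreover have "tensor_form n1 n2 n3 T x u w = 0" using assms by (auto simp: tensor_form_def min_def split: if_splits)
  ultimately show False by simp
qed

subsection \<open>The asymptotic bound\<close>

text \<open>The limit is the supremum of the roots, finite because of \<open>C\<close>. For fixed
  \<open>m\<close>, \<open>a n\<close> is at least \<open>a m ^ (n div m)\<close>, since the factor
  for the remainder is at least 1.\<close>

lemma supermultiplicative_root_limit:
  fixes a :: "nat \<Rightarrow> real"
  assumes ge1: "\<And>m. a m \<ge> 1" and mult: "\<And>m k. a (m + k) \<ge> a m * a k" and bound: "\<And>m. a m \<le> C ^ m"
  shows "\<exists>L. (\<lambda>m. root m (a m)) \<longlonglongrightarrow> L \<and> (\<forall>m>0. root m (a m) \<le> L)"
proof -
  have C: "C \<ge> 1" using ge1[of 1] bound[of 1] by simp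
  have le_C: "root m (a m) \<le> C" if "m > 0" for m
    using real_root_le_mono[OF that bound[of m]] C that by (simp add: real_root_power_cancel)
  define L where "L = (SUP m\<in>{0<..}. root m (a m))"
  have bdd: "bdd_above ((\<lambda>m. root m (a m)) ` {0<..})"
    using le_C by (auto intro!: bdd_aboveI2)
  have le_L: "root m (a m) \<le> L" if "m > 0" for m
    unfolding L_def using that by (intro cSUP_upper bdd) simp
  have pow: "a (q * m) \<ge> a m ^ q" for q m
  proof (induction q)
    case 0
    show ?case using ge1[of 0] by simp
  next
    case (Suc q)
    have "a m ^ Suc q \<le> a m * a (q * m)"
      using Suc ge1[of m] by (simp add: mult_left_mono)
    also have "\<dots> \<le> a (Suc q * m)" using mult[of m "q * m"] by simp
    finally show ?case .
  qed
  have lower: "a m powr (1 / m - 1 / n) \<le> root n (a n)" if "m > 0" "n > 0" for m n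
  proof -
    have "n = n div m * m + n mod m" by simp
    then have "a n \<ge> a (n div m * m) * a (n mod m)" using mult by metis
    moreover have "a (n div m * m) * a (n mod m) \<ge> a (n div m * m) * 1"
      using ge1 by (intro mult_left_mono) (auto intro: order_trans[OF zero_le_one])
    ultimately have "a m ^ (n div m) \<le> a n" using pow[where m = m and q = "n div m"] by linarith
    then have "a m powr (n div m) \<le> a n" using ge1[of m] by (subst powr_realpow) auto
    then have "(a m powr (n div m)) powr (1 / n) \<le> a n powr (1 / n)"
      by (intro powr_mono2) auto
    moreover have "a m powr (1 / m - 1 / n) \<le> (a m powr (n div m)) powr (1 / n)"
    proof -
      \<comment> \<open>Rounding down costs at most 1, hence at most \<open>1 / n\<close> in the
        exponent, which tends to 0.\<close>
      have "real n / real m \<le> real (n div m) + 1"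
        by (metis floor_divide_of_nat_eq of_int_of_nat_eq real_of_int_floor_add_one_ge)
      then have "real n / real m / real n \<le> (real (n div m) + 1) / real n"
        by (rule divide_right_mono) simp
      then have "1 / real m - 1 / real n \<le> real (n div m) * (1 / real n)"
        using that by (simp add: add_divide_distrib)
      then show ?thesis unfolding powr_powr using ge1[of m] by (intro powr_mono)
    qed
    moreover have "root n (a n) = a n powr (1 / n)"
      using ge1[of n] that(2) by (intro root_powr_inverse) auto
    ultimately show ?thesis by linarith
  qed
  have "(\<lambda>m. root m (a m)) \<longlonglongrightarrow> L"
  proof (rule order_tendstoI)
    fix y assume "y < L"
    then obtain m where m: "m > 0" "y < root m (a m)"
      unfolding L_def using less_cSUP_iff[OF _ bdd] by auto
    have "(\<lambda>n. a m powr (1 / m - 1 / n)) \<longlonglongrightarrow> a m powr (1 / m - 0)"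
      using ge1[of m] by (intro tendsto_intros lim_1_over_n) auto
    moreover have "y < a m powr (1 / m - 0)"
      using m ge1[of m] by (simp add: root_powr_inverse)
    ultimately have "\<forall>\<^sub>F n in sequentially. y < a m powr (1 / m - 1 / n)"
      by (rule order_tendstoD)
    then show "\<forall>\<^sub>F n in sequentially. y < root n (a n)"
      using eventually_gt_at_top[of 0]
    proof eventually_elim
      case (elim n)
      then show ?case using lower[OF m(1), of n] by linarith
    qed
  next
    fix y assume "L < y"
    show "\<forall>\<^sub>F n in sequentially. root n (a n) < y"
      using eventually_gt_at_top[of 0]
    proof eventually_elim
      case (elim n)
      then show ?case using le_L[of n] \<open>L < y\<close> by linarith
    qed
  qed
  then show ?thesis using le_L by blast
qed

theorem theorem2p11:
  fixes T :: "'a::field tensor3" and n1 n2 n3 :: nat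
  assumes "T \<in> carrier_tensor3 n1 n2 n3"
    and "concise n1 n2 n3 T"
  shows "convergent (subrank_root n1 n2 n3 T) \<and>
         asymptotic_subrank n1 n2 n3 T \<ge> root 4 (real (min n1 (min n2 n3)))"
proof (cases "min n1 (min n2 n3) = 0")
  case True
  \<comment> \<open>At \<open>m = 0\<close> this holds because \<open>root 0\<close> is constantly
    0; for positive \<open>m\<close> some leg of the power is empty.\<close>
  have "subrank_root n1 n2 n3 T m = 0" for m
  proof (cases "m = 0")
    case False
    then have "min (n1 ^ m) (min (n2 ^ m) (n3 ^ m)) = 0" using True by (auto simp: min_def split: if_splits)
    from subrank_eq_0[OF this, of "kron3_power n1 n2 n3 T m"] show ?thesis by (simp add: subrank_root_def)
  qed (simp add: subrank_root_def)
  then have "subrank_root n1 n2 n3 T = (\<lambda>_. 0)" by blast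
  then show ?thesis
    unfolding asymptotic_subrank_def True by (simp add: convergent_const)
next
  case False
  define N where "N = min n1 (min n2 n3)"
  define P where "P m = kron3_power n1 n2 n3 T m" for m
  define a where "a m = subrank (n1 ^ m) (n2 ^ m) (n3 ^ m) (P m)" for m
  have indep: "indep_slices3 (n1 ^ m) (n2 ^ m) (n3 ^ m) (P m)" for m
    unfolding P_def by (intro indep_slices3_kron3_power indep_slices3_of_concise assms(2))
  have P_add: "P (m + k) = kron3 (n1 ^ k) (n2 ^ k) (n3 ^ k) (P m) (P k)" for m k
    unfolding P_def by (rule kron3_power_add)
  have ge1: "a m \<ge> 1" for m
    unfolding a_def using False by (intro subrank_pos indep) (auto simp: min_def split: if_splits)
  have mult: "a m * a k \<le> a (m + k)" for m k
    unfolding a_def P_add power_add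
    by (intro le_subrank restricts_to_unit_kron3 restricts_to_unit_subrank)
  have bound: "a m \<le> n1 ^ m" for m
    unfolding a_def by (rule subrank_le)
  \<comment> \<open>The square of the \<open>m\<close>-th power is the power \<open>m + m\<close>;
    this doubling and the squared subrank together produce the fourth root.\<close>
  have square: "N ^ m \<le> 4 * (a (m + m))\<^sup>2" for m
  proof -
    have "N ^ m \<le> min (n1 ^ m) (min (n2 ^ m) (n3 ^ m))"
      unfolding N_def by (auto intro!: power_mono)
    also have "\<dots> \<le> 4 * (a (m + m))\<^sup>2"
      unfolding a_def P_add power_add by (rule subrank_kron3_square_ge[OF indep])
    finally show ?thesis .
  qed
  have "real (a m) \<ge> 1" "real (a m) * real (a k) \<le> real (a (m + k))" "real (a m) \<le> real n1 ^ m" for m k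
    using ge1[of m] mult[of m k] bound[of m] by (simp_all flip: of_nat_mult of_nat_power)
  from supermultiplicative_root_limit[of "\<lambda>m. real (a m)", OF this] obtain L
    where lim: "(\<lambda>m. root m (real (a m))) \<longlonglongrightarrow> L" and le_L: "\<And>m. m > 0 \<Longrightarrow> root m (real (a m)) \<le> L"
    by blast
  have L: "L \<ge> 1" using le_L[of 1] ge1[of 1] by simp
  have "real N \<le> L ^ 4"
  proof (rule ccontr)
    assume "\<not> real N \<le> L ^ 4"
    \<comment> \<open>A ratio above 1 has a power above 4, contradicting
      \<open>N ^ m \<le> 4 * (L ^ 4) ^ m\<close>; here the constant disappears.\<close>
    then have "real N / L ^ 4 > 1" using L by (simp add: field_simps)
    then obtain m where m: "4 < (real N / L ^ 4) ^ m"
      using real_arch_pow by blast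
    then have "m > 0" by (cases m) auto
    then have "real (a (m + m)) \<le> L ^ (m + m)"
      using le_L[of "m + m"] L real_root_le_iff[of "m + m" "real (a (m + m))" "L ^ (m + m)"]
      by (simp add: real_root_power_cancel)
    then have "(real (a (m + m)))\<^sup>2 \<le> (L ^ (m + m))\<^sup>2" by (rule power_mono) simp
    moreover have "real N ^ m \<le> 4 * (real (a (m + m)))\<^sup>2"
    proof -
      have "real (N ^ m) \<le> real (4 * (a (m + m))\<^sup>2)"
        using square[of m] by (simp only: of_nat_le_iff)
      then show ?thesis by simp
    qed
    moreover have "(L ^ (m + m))\<^sup>2 = (L ^ 4) ^ m"
      unfolding power_mult[symmetric] by (rule arg_cong[of _ _ "power L"]) simp
    ultimately have "real N ^ m \<le> 4 * (L ^ 4) ^ m" by linarith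
    then show False using m L by (simp add: power_divide field_simps)
  qed
  then have "root 4 (real N) \<le> root 4 (L ^ 4)" by simp
  also have "\<dots> = L" using L by (intro real_root_power_cancel) auto
  finally have "root 4 (real N) \<le> L" .
  moreover have lim': "subrank_root n1 n2 n3 T \<longlonglongrightarrow> L"
    using lim unfolding subrank_root_def a_def P_def .
  ultimately show ?thesis
    unfolding asymptotic_subrank_def N_def using limI[OF lim'] by (auto simp: convergent_def)
qed

end
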